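(* Let $\mathcal A=\{a_1,\dots,a_m\}\subset\mathbb R^n$ be a finite nonempty set, let $\mathcal M=\mathrm{conv}(\mathcal A)$, and let $f:\mathbb R^n\to\mathbb R$ be continuously differentiable. Let $\{x^k\}_{k\ge 0}$ be a sequence of points produced by the Optimize, Refine & Drop (ORD) algorithm (defined in the context) applied to $\min_{x\in\mathcal M} f(x)$. Then at least one limit point $x^*$ of $\{x^k\}$ exists such that $x^*$ is stationary for the problem $\min_{x\in\mathcal M} f(x)$.
   Context: Notation. $\Delta_{p-1}=\{w\in\mathbb R^p: e^Tw=1,\ w\ge 0\}$, where $e$ is the all-ones vector; $e_i$ is the $i$-th canonical basis vector. A point $x^*\in\mathcal M$ is stationary for $\min_{x\in\mathcal M}f(x)$ if $\nabla f(x^* )^T(x-x^* )\ge 0$ for all $x\in\mathcal M$ (equivalently, $\nabla f(x^* )^T(a-x^* )\ge0$ for all $a\in\mathcal A$). Line Search Procedure$(z,d,\hat\alpha,\gamma,\delta)$ for $\varphi$ on $\Delta_{p-1}$: (1) Compute the largest $\bar\alpha$ with $z+\bar\alpha d\in\Delta_{p-1}$ and set $\alpha=\min\{\bar\alpha,\hat\alpha\}$. (2) If $\alpha>0$ and $\varphi(z+\alpha d)\le\varphi(z)-\gamma\alpha^2$, go to (6). (3) Compute the largest $\bar\alpha$ with $z-\bar\alpha d\in\Delta_{p-1}$ and set $\alpha=\min\{\bar\alpha,\hat\alpha\}$. (4) If $\alpha>0$ and $\varphi(z-\alpha d)\le\varphi(z)-\gamma\alpha^2$, set $d=-d$ and go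 to (6). (5) Set $\alpha=0$ and go to (8). (6) Let $\beta=\min\{\bar\alpha,\alpha/\delta\}$. (7) While $\alpha<\bar\alpha$ and $\varphi(z+\beta d)\le\varphi(z)-\gamma\beta^2$: set $\alpha=\beta$ and then $\beta=\min\{\bar\alpha,\alpha/\delta\}$. (8) Return $\alpha,d$. Algorithm DF-SIMPLEX with tolerance $\epsilon>0$, for $\min_{y\in\Delta_{p-1}}\varphi(y)$ with $\varphi:\mathbb R^p\to\mathbb R$ continuously differentiable. Input: $y^0\in\Delta_{p-1}$, $\tau\in(0,1]$, $\theta\in(0,1)$, $\gamma>0$, $\delta\in(0,1)$, $\hat\alpha^0_1,\dots,\hat\alpha^0_p>0$. At each iteration $l=0,1,\dots$: choose $j_l$ with $y^l_{j_l}\ge\tau\max_i y^l_i$; set $z^l_1=y^l$. For $i=1,\dots,p$: if $i\ne j_l$, compute $\alpha,d$ by Line Search Procedure$(z^l_i,e_i-e_{j_l},\hat\alpha^l_i,\gamma,\delta)$, and set $\hat\alpha^{l+1}_i=\max\{\theta\hat\alpha^l_i,\epsilon\}$ if $\alpha=0$, $\hat\alpha^{l+1}_i=\alpha$ otherwise; if $i=j_l$, set $\alpha=0$, $d=0$. Set $\alpha^l_i=\alpha$, $d^l_i=d$, $z^l_{i+1}=z^l_i+\alpha^l_id^l_i$. After the loop on $i$, set $\hat\alpha^{l+1}_{j_l}=\min\bigl(\{\hat\alpha^{l+1}_i: i\ne j_l\}\cup\{\hat\alpha^l_{j_l}\}\bigr)$ and $y^{l+1}=z^l_{p+1}$. The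 algorithm stops and returns $y^l$ at the first iteration $l$ such that $\hat\alpha^l_i=\epsilon$ for all $i\in\{1,\dots,p\}$ and $\alpha^l_i=0$ for all $i\ne j_l$. ORD algorithm. Choose positive scalars $\epsilon^k$ decreasing to $0$, $\mathcal A^0\subseteq\mathcal A$, $a_{i_0}\in\mathcal A^0$; set $x^0=a_{i_0}$, $y^0=e_{i_0}\in\mathbb R^{|\mathcal A^0|}$ (the basis vector corresponding to the atom $a_{i_0}$); choose $\hat\mu^0\in(0,1)$, $\gamma>0$, $\theta\in(0,1)$ ($\gamma,\theta$ may differ from the ones used inside DF-SIMPLEX). For $k=0,1,\dots$: Optimize phase: let $A^k$ be the matrix whose columns are the atoms in $\mathcal A^k$ (so $x^k=A^ky^k$); run DF-SIMPLEX from $y^k$ with tolerance $\epsilon^k$ on $\min_{y\in\Delta_{|\mathcal A^k|-1}}\varphi^k(y)$, $\varphi^k(y)=f(A^ky)$, let $\bar y^k$ be the returned point and set $\bar x^k=A^k\bar y^k$. Refine phase: if there exist $a_{i_k}\in\mathcal A\setminus\mathcal A^k$ and $\mu^k\in[\hat\mu^k,1]$ with $f(\bar x^k+\mu^k(a_{i_k}-\bar x^k))\le f(\bar x^k)-\gamma(\mu^k)^2$, then set $x^{k+1}=\bar x^k+\mu^k(a_{i_k}-\bar x^k)$, $\mathcal R^k=\{a_{i_k}\}$, $\hat\mu^{k+1}=\hat\mu^k$ for one such choice; otherwise set $x^{k+1}=\bar x^k$, $\mathcal R^k=\emptyset$, $\hat\mu^{k+1}=\theta\hat\mu^k$. Drop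 phase: choose any subset $\mathcal D^k\subseteq\{a\in\mathcal A^k: a=A^ke_h \text{ and } \bar y^k_h=0\}$; let $\mathcal A^{k+1}=(\mathcal A^k\cup\mathcal R^k)\setminus\mathcal D^k$ and choose $y^{k+1}\in\Delta_{|\mathcal A^{k+1}|-1}$ such that $x^{k+1}=A^{k+1}y^{k+1}$. Conventions: the DF-SIMPLEX parameters $\tau,\theta,\gamma,\delta$ are the same for all $k$; each inner run of DF-SIMPLEX is finite and returns $\bar y^k$ (if $|\mathcal A^k|=1$ the feasible set is a single point and $\bar y^k=y^k$). *)

theory Defs
  imports
    "HOL-Analysis.Analysis"
    "HOL-Homology.Simplices"
    "HOL-Library.While_Combinator"
begin

text \<open>
  The gradient is the unique vector \<^term>\<open>g\<close> with \<^prop>\<open>GDERIV f x :> g\<close>.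
\<close>

definition continuously_differentiable :: "('a::real_inner \<Rightarrow> real) \<Rightarrow> bool" where
  "continuously_differentiable f \<longleftrightarrow>
     (\<exists>g. (\<forall>x. GDERIV f x :> g x) \<and> continuous_on UNIV g)"

definition stationary_point :: "('a::real_inner \<Rightarrow> real) \<Rightarrow> 'a set \<Rightarrow> 'a \<Rightarrow> bool" where
  "stationary_point f M x \<longleftrightarrow>
     x \<in> M \<and> (\<exists>g. GDERIV f x :> g \<and> (\<forall>y\<in>M. g \<bullet> (y - x) \<ge> 0))"

text \<open>
  The dimension \<open>p\<close> of the inner problems changes along the algorithm, so points of \<open>\<real>\<^sup>p\<close> are
  functions of type \<^typ>\<open>nat \<Rightarrow> real\<close> whose coordinates are indexed by \<open>0, \<dots>, p - 1\<close>.  For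
  \<open>p \<ge> 1\<close>, \<^term>\<open>standard_simplex (p - 1)\<close> consists of the nonnegative vectors with coordinate sum
  \<open>1\<close> that vanish outside these indices.
\<close>

type_synonym coords = "nat \<Rightarrow> real"

definition basis_vec :: "nat \<Rightarrow> coords" where
  "basis_vec i = (\<lambda>h. if h = i then 1 else 0)"

definition move :: "coords \<Rightarrow> real \<Rightarrow> coords \<Rightarrow> coords" where
  "move z \<alpha> d = (\<lambda>h. z h + \<alpha> * d h)"

definition max_step :: "nat \<Rightarrow> coords \<Rightarrow> coords \<Rightarrow> real" where
  "max_step p z d = (GREATEST \<alpha>. move z \<alpha> d \<in> standard_simplex (p - 1))"

definition sufficient_decrease ::
  "(coords \<Rightarrow> real) \<Rightarrow> real \<Rightarrow> coords \<Rightarrow> real \<Rightarrow> coords \<Rightarrow> bool" where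
  "sufficient_decrease \<phi> \<gamma> z \<alpha> d \<longleftrightarrow> \<phi> (move z \<alpha> d) \<le> \<phi> z - \<gamma> * \<alpha>\<^sup>2"

text \<open>
  The loop state is the pair \<open>(\<alpha>, \<beta>)\<close>.  For \<open>\<alpha> > 0\<close> and \<open>0 < \<delta> < 1\<close> the loop terminates, because
  \<open>\<alpha>\<close> grows by the factor \<open>1 / \<delta>\<close> until it reaches \<open>\<alpha>max\<close>.
\<close>

definition expand_step ::
  "(coords \<Rightarrow> real) \<Rightarrow> real \<Rightarrow> real \<Rightarrow> coords \<Rightarrow> coords \<Rightarrow> real \<Rightarrow> real \<Rightarrow> real" where
  "expand_step \<phi> \<gamma> \<delta> z d \<alpha>max \<alpha>0 =
     fst (while
       (\<lambda>(\<alpha>, \<beta>). \<alpha> < \<alpha>max \<and> sufficient_decrease \<phi> \<gamma> z \<beta> d)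
       (\<lambda>(\<alpha>, \<beta>). (\<beta>, min \<alpha>max (\<beta> / \<delta>)))
       (\<alpha>0, min \<alpha>max (\<alpha>0 / \<delta>)))"

definition line_search ::
  "nat \<Rightarrow> (coords \<Rightarrow> real) \<Rightarrow> real \<Rightarrow> real \<Rightarrow> coords \<Rightarrow> coords \<Rightarrow> real \<Rightarrow> real \<times> coords" where
  "line_search p \<phi> \<gamma> \<delta> z d \<alpha>hat =
     (let \<alpha>max = max_step p z d; \<alpha> = min \<alpha>max \<alpha>hat in
      if \<alpha> > 0 \<and> sufficient_decrease \<phi> \<gamma> z \<alpha> d
      then (expand_step \<phi> \<gamma> \<delta> z d \<alpha>max \<alpha>, d)
      else
        (let d' = (\<lambda>h. - d h); \<alpha>max' = max_step p z d'; \<alpha>' = min \<alpha>max' \<alpha>hat in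
         if \<alpha>' > 0 \<and> sufficient_decrease \<phi> \<gamma> z \<alpha>' d'
         then (expand_step \<phi> \<gamma> \<delta> z d' \<alpha>max' \<alpha>', d')
         else (0, d)))"

text \<open>
  One iteration from \<open>(y, \<alpha>hat)\<close> to \<open>(y', \<alpha>hat')\<close>, with pivot index \<open>j\<close>, step sizes \<open>\<alpha> i\<close>,
  directions \<open>d i\<close> and intermediate points \<open>z i\<close>.
\<close>

definition df_simplex_iteration ::
  "nat \<Rightarrow> (coords \<Rightarrow> real) \<Rightarrow> real \<Rightarrow> real \<Rightarrow> real \<Rightarrow> real \<Rightarrow> real \<Rightarrow> coords \<Rightarrow> coords \<Rightarrow>
   nat \<Rightarrow> coords \<Rightarrow> (nat \<Rightarrow> coords) \<Rightarrow> (nat \<Rightarrow> coords) \<Rightarrow> coords \<Rightarrow> coords \<Rightarrow> bool" where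
  "df_simplex_iteration p \<phi> \<tau> \<theta> \<gamma> \<delta> \<epsilon> y \<alpha>hat j \<alpha> d z y' \<alpha>hat' \<longleftrightarrow>
     j < p \<and> y j \<ge> \<tau> * Max (y ` {..<p}) \<and>
     z 0 = y \<and>
     (\<forall>i<p.
        (if i = j then \<alpha> i = 0 \<and> d i = (\<lambda>h. 0)
         else
           (\<alpha> i, d i) = line_search p \<phi> \<gamma> \<delta> (z i) (\<lambda>h. basis_vec i h - basis_vec j h) (\<alpha>hat i) \<and>
           \<alpha>hat' i = (if \<alpha> i = 0 then max (\<theta> * \<alpha>hat i) \<epsilon> else \<alpha> i)) \<and>
        z (Suc i) = move (z i) (\<alpha> i) (d i)) \<and>
     \<alpha>hat' j = Min (\<alpha>hat' ` ({..<p} - {j}) \<union> {\<alpha>hat j}) \<and>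
     y' = z p"

definition df_simplex_stops :: "nat \<Rightarrow> real \<Rightarrow> coords \<Rightarrow> nat \<Rightarrow> coords \<Rightarrow> bool" where
  "df_simplex_stops p \<epsilon> \<alpha>hat j \<alpha> \<longleftrightarrow>
     (\<forall>i<p. \<alpha>hat i = \<epsilon>) \<and> (\<forall>i<p. i \<noteq> j \<longrightarrow> \<alpha> i = 0)"

text \<open>
  \<open>ybar\<close> is a possible result of a finite run started at \<open>y0\<close>; the run is nondeterministic in the
  initial step sizes and in the pivot indices.  The stopping test at iteration \<open>L\<close> uses the step
  sizes computed in that iteration.  If \<open>p = 1\<close>, the feasible set is a single point and no iteration
  is performed.
\<close>

definition df_simplex ::
  "nat \<Rightarrow> (coords \<Rightarrow> real) \<Rightarrow> real \<Rightarrow> real \<Rightarrow> real \<Rightarrow> real \<Rightarrow> real \<Rightarrow> coords \<Rightarrow> coords \<Rightarrow> bool" where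
  "df_simplex p \<phi> \<tau> \<theta> \<gamma> \<delta> \<epsilon> y0 ybar \<longleftrightarrow>
     (if p = 1 then ybar = y0
      else (\<exists>y \<alpha>hat j \<alpha> d z L.
        y 0 = y0 \<and> (\<forall>i<p. \<alpha>hat 0 i > 0) \<and>
        (\<forall>l\<le>L. df_simplex_iteration p \<phi> \<tau> \<theta> \<gamma> \<delta> \<epsilon> (y l) (\<alpha>hat l) (j l) (\<alpha> l) (d l) (z l)
                 (y (Suc l)) (\<alpha>hat (Suc l))) \<and>
        (\<forall>l<L. \<not> df_simplex_stops p \<epsilon> (\<alpha>hat l) (j l) (\<alpha> l)) \<and>
        df_simplex_stops p \<epsilon> (\<alpha>hat L) (j L) (\<alpha> L) \<and>
        ybar = y L))"

text \<open>
  A finite set of atoms is given by a list without repetitions, whose entries are the columns of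
  the corresponding matrix; \<^term>\<open>mat_apply as y\<close> is the matrix-vector product.
\<close>

definition mat_apply :: "'a::real_vector list \<Rightarrow> coords \<Rightarrow> 'a" where
  "mat_apply as y = (\<Sum>h<length as. y h *\<^sub>R as ! h)"

definition optimize_phase ::
  "('a::real_vector \<Rightarrow> real) \<Rightarrow> real \<Rightarrow> real \<Rightarrow> real \<Rightarrow> real \<Rightarrow> real \<Rightarrow> 'a list \<Rightarrow>
   coords \<Rightarrow> coords \<Rightarrow> 'a \<Rightarrow> bool" where
  "optimize_phase f \<tau> \<theta> \<gamma> \<delta> \<epsilon> as y ybar xbar \<longleftrightarrow>
     df_simplex (length as) (\<lambda>v. f (mat_apply as v)) \<tau> \<theta> \<gamma> \<delta> \<epsilon> y ybar \<and>
     xbar = mat_apply as ybar"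

definition refine_success ::
  "('a::real_vector \<Rightarrow> real) \<Rightarrow> 'a set \<Rightarrow> real \<Rightarrow> 'a set \<Rightarrow> 'a \<Rightarrow> real \<Rightarrow> 'a \<Rightarrow> real \<Rightarrow> bool" where
  "refine_success f A \<gamma> Ak xbar \<mu>hat a \<mu> \<longleftrightarrow>
     a \<in> A - Ak \<and> \<mu> \<in> {\<mu>hat..1} \<and>
     f (xbar + \<mu> *\<^sub>R (a - xbar)) \<le> f xbar - \<gamma> * \<mu>\<^sup>2"

definition refine_phase ::
  "('a::real_vector \<Rightarrow> real) \<Rightarrow> 'a set \<Rightarrow> real \<Rightarrow> real \<Rightarrow> 'a set \<Rightarrow> 'a \<Rightarrow> real \<Rightarrow>
   'a \<Rightarrow> 'a set \<Rightarrow> real \<Rightarrow> bool" where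
  "refine_phase f A \<theta> \<gamma> Ak xbar \<mu>hat x' R \<mu>hat' \<longleftrightarrow>
     (if \<exists>a \<mu>. refine_success f A \<gamma> Ak xbar \<mu>hat a \<mu>
      then \<exists>a \<mu>. refine_success f A \<gamma> Ak xbar \<mu>hat a \<mu> \<and>
             x' = xbar + \<mu> *\<^sub>R (a - xbar) \<and> R = {a} \<and> \<mu>hat' = \<mu>hat
      else x' = xbar \<and> R = {} \<and> \<mu>hat' = \<theta> * \<mu>hat)"

definition drop_phase ::
  "'a::real_vector list \<Rightarrow> coords \<Rightarrow> 'a set \<Rightarrow> 'a \<Rightarrow> 'a list \<Rightarrow> coords \<Rightarrow> bool" where
  "drop_phase as ybar R x' as' y' \<longleftrightarrow>
     (\<exists>D. D \<subseteq> {as ! h | h. h < length as \<and> ybar h = 0} \<and>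
          distinct as' \<and> set as' = (set as \<union> R) - D) \<and>
     y' \<in> standard_simplex (length as' - 1) \<and> x' = mat_apply as' y'"

text \<open>
  \<open>x\<close> is a sequence of main iterates of the algorithm for minimizing \<open>f\<close> over the convex hull of
  \<open>A\<close>.  The parameters \<open>\<tau> \<theta> \<gamma> \<delta>\<close> are those of the inner solver, \<open>\<theta>ord \<gamma>ord\<close> those of the refine
  phase, \<open>\<epsilon>\<close> is the sequence of tolerances and \<open>\<mu>0\<close> the initial refine step size.
\<close>

definition ord_sequence ::
  "('a::real_vector \<Rightarrow> real) \<Rightarrow> 'a set \<Rightarrow> real \<Rightarrow> real \<Rightarrow> real \<Rightarrow> real \<Rightarrow> real \<Rightarrow> real \<Rightarrow>
   (nat \<Rightarrow> real) \<Rightarrow> real \<Rightarrow> (nat \<Rightarrow> 'a) \<Rightarrow> bool" where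
  "ord_sequence f A \<tau> \<theta> \<gamma> \<delta> \<theta>ord \<gamma>ord \<epsilon> \<mu>0 x \<longleftrightarrow>
     (\<exists>as y \<mu>hat ybar xbar R.
        distinct (as 0) \<and> set (as 0) \<subseteq> A \<and>
        (\<exists>h<length (as 0). x 0 = as 0 ! h \<and> y 0 = basis_vec h) \<and>
        \<mu>hat 0 = \<mu>0 \<and>
        (\<forall>k.
           optimize_phase f \<tau> \<theta> \<gamma> \<delta> (\<epsilon> k) (as k) (y k) (ybar k) (xbar k) \<and>
           refine_phase f A \<theta>ord \<gamma>ord (set (as k)) (xbar k) (\<mu>hat k)
             (x (Suc k)) (R k) (\<mu>hat (Suc k)) \<and>
           drop_phase (as k) (ybar k) (R k) (x (Suc k)) (as (Suc k)) (y (Suc k))))"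

end

(* Every failed refine phase shrinks the trial step by a constant factor, while every successful one
   decreases f by at least a multiple of its square; since f is bounded below on the convex hull of
   the atoms, infinitely many refine phases fail and the trial steps tend to 0.  Along a subsequence
   of failures the working set and the final pivot j of the inner solver are constant and the inner
   solutions converge.  Failure of the refine test gives a nonnegative directional derivative at the
   limit towards the atoms outside the working set.  Inside it, the line searches that fail when the
   inner solver stops give nonnegative derivatives in the directions a_i - a_j, and in the opposite
   direction whenever the weight of a_i is positive in the limit; the pivot rule keeps the limit
   weight of a_j positive, so no step towards a_i is blocked. *)

theory Submission
  imports Defs "HOL-Complex_Analysis.Great_Picard"
begin

section \<open>The standard simplex and its edge directions\<close>

text \<open>The bounds \<open>y h <= 1\<close> in \<open>standard_simplex\<close> are recovered
  because a nonnegative summand is at most the total; \<open>0 < p\<close> makes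
  \<open>p - 1\<close> a true predecessor.\<close>

lemma standard_simplex_iff:
  assumes "0 < p"
  shows "y \<in> standard_simplex (p - 1) \<longleftrightarrow>
    (\<forall>h. 0 \<le> y h) \<and> (\<forall>h\<ge>p. y h = 0) \<and> (\<Sum>h<p. y h) = 1"
proof -
  have sets: "{..p - 1} = {..<p}" "\<And>h. h > p - 1 \<longleftrightarrow> h \<ge> p"
    using assms by auto
  have "y h \<le> 1" if nn: "\<forall>h. 0 \<le> y h" and out: "\<forall>h\<ge>p. y h = 0" and s: "(\<Sum>h<p. y h) = 1" for h
  proof (cases "h < p")
    case True
    then show ?thesis using member_le_sum[of h "{..<p}" y] nn s by auto
  qed (use out in auto)
  then show ?thesis
    unfolding standard_simplex_def sets by auto
qed

lemma sum_basis_vec: "i < p \<Longrightarrow> (\<Sum>h<p. basis_vec i h) = 1"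
  unfolding basis_vec_def by (subst sum.delta) auto

text \<open>An abbreviation, so that it is the very term that occurs in
  \<open>df_simplex_iteration\<close>.\<close>

abbreviation edge_dir :: "nat \<Rightarrow> nat \<Rightarrow> coords" where
  "edge_dir i j \<equiv> (\<lambda>h. basis_vec i h - basis_vec j h)"

text \<open>Only the coordinates \<open>i\<close> and \<open>j\<close> change, by opposite amounts,
  so the sum is preserved and only the signs of \<open>z i + \<alpha>\<close> and
  \<open>z j - \<alpha>\<close> matter.\<close>

lemma move_edge_dir_in_simplex_iff:
  assumes z: "z \<in> standard_simplex (p - 1)" and ij: "i < p" "j < p" "i \<noteq> j"
  shows "move z \<alpha> (edge_dir i j) \<in> standard_simplex (p - 1) \<longleftrightarrow> - z i \<le> \<alpha> \<and> \<alpha> \<le> z j"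
proof -
  have p: "0 < p" using ij by simp
  note zp = z[unfolded standard_simplex_iff[OF p]]
  have "(\<Sum>h<p. move z \<alpha> (edge_dir i j) h) = 1"
    using zp sum_basis_vec[OF ij(1)] sum_basis_vec[OF ij(2)]
    by (simp add: move_def sum.distrib sum_subtractf flip: sum_distrib_left)
  moreover have "\<forall>h\<ge>p. move z \<alpha> (edge_dir i j) h = 0"
    using zp ij by (auto simp: move_def basis_vec_def)
  moreover have "(\<forall>h. 0 \<le> move z \<alpha> (edge_dir i j) h) \<longleftrightarrow> - z i \<le> \<alpha> \<and> \<alpha> \<le> z j"
  proof
    assume *: "\<forall>h. 0 \<le> move z \<alpha> (edge_dir i j) h"
    show "- z i \<le> \<alpha> \<and> \<alpha> \<le> z j"
      using *[rule_format, of i] *[rule_format, of j] ij by (auto simp: move_def basis_vec_def)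
  qed (use zp ij in \<open>auto simp: move_def basis_vec_def\<close>)
  ultimately show ?thesis
    unfolding standard_simplex_iff[OF p] by blast
qed

lemma max_step_edge_dir:
  assumes z: "z \<in> standard_simplex (p - 1)" and ij: "i < p" "j < p" "i \<noteq> j"
  shows "max_step p z (edge_dir i j) = z j"
proof -
  have nn: "0 \<le> z i" "0 \<le> z j"
    using z ij by (simp_all add: standard_simplex_def)
  show ?thesis
    unfolding max_step_def move_edge_dir_in_simplex_iff[OF assms]
    by (rule Greatest_equality) (use nn in auto)
qed

section \<open>The line search\<close>

text \<open>The loop replaces \<open>\<alpha>\<close> only by a \<open>\<beta>\<close> that has just
  passed the decrease test. Reasoning about \<open>while\<close> also requires termination, proved
  by a logarithmic measure.\<close>

lemma expand_step_sound:
  assumes \<delta>: "0 < \<delta>" "\<delta> < 1" and \<alpha>0: "0 < \<alpha>0" "\<alpha>0 \<le> \<alpha>max"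
    and dec: "sufficient_decrease \<phi> \<gamma> z \<alpha>0 d"
  shows "0 < expand_step \<phi> \<gamma> \<delta> z d \<alpha>max \<alpha>0 \<and> expand_step \<phi> \<gamma> \<delta> z d \<alpha>max \<alpha>0 \<le> \<alpha>max \<and>
    sufficient_decrease \<phi> \<gamma> z (expand_step \<phi> \<gamma> \<delta> z d \<alpha>max \<alpha>0) d"
proof -
  let ?b = "\<lambda>(\<alpha>, \<beta>). \<alpha> < \<alpha>max \<and> sufficient_decrease \<phi> \<gamma> z \<beta> d"
  let ?c = "\<lambda>(\<alpha>, \<beta>). (\<beta>, min \<alpha>max (\<beta> / \<delta>))"
  \<comment> \<open>The equation for \<open>\<beta>\<close> carries its positivity and its upper
    bound to the next round, and it makes the measure drop.\<close>
  let ?P = "\<lambda>(\<alpha>, \<beta>). 0 < \<alpha> \<and> \<alpha> \<le> \<alpha>max \<and> sufficient_decrease \<phi> \<gamma> z \<alpha> d \<and> \<beta> = min \<alpha>max (\<alpha> / \<delta>)"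
  let ?Q = "\<lambda>(\<alpha>, \<beta>::real). 0 < \<alpha> \<and> \<alpha> \<le> \<alpha>max \<and> sufficient_decrease \<phi> \<gamma> z \<alpha> d"
  \<comment> \<open>Bounds the number of factors \<open>1 / \<delta>\<close> still needed to reach \<open>\<alpha>max\<close>.\<close>
  let ?m = "\<lambda>(\<alpha>, \<beta>::real). nat \<lceil>log (1 / \<delta>) (\<alpha>max / \<alpha>)\<rceil>"
  have D: "1 < 1 / \<delta>" using \<delta> by simp
  have "?Q (while ?b ?c (\<alpha>0, min \<alpha>max (\<alpha>0 / \<delta>)))"
  proof (rule while_rule[where P = ?P and r = "Wellfounded.measure ?m"])
    show "?P (?c s)" if "?P s" "?b s" for s
      using that \<delta> by (auto simp: min_def)
    show "(?c s, s) \<in> Wellfounded.measure ?m" if "?P s" "?b s" for s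
    proof -
      obtain \<alpha> \<beta> where s: "s = (\<alpha>, \<beta>)" by fastforce
      have a: "0 < \<alpha>" "\<alpha> < \<alpha>max" "\<beta> = min \<alpha>max (\<alpha> / \<delta>)" using that s by auto
      have pos: "0 < log (1 / \<delta>) (\<alpha>max / \<alpha>)"
        using a D by (subst zero_less_log_cancel_iff) auto
      have "nat \<lceil>log (1 / \<delta>) (\<alpha>max / \<beta>)\<rceil> < nat \<lceil>log (1 / \<delta>) (\<alpha>max / \<alpha>)\<rceil>"
      \<comment> \<open>A capped step makes the new ratio 1 and the measure 0; otherwise the
        logarithm falls by exactly 1. Since it was positive before, \<open>nat\<close> does not hide
        the drop.\<close>
      proof (cases "\<alpha>max \<le> \<alpha> / \<delta>")
        case True
        then have "\<beta> = \<alpha>max" using a by simp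
        then show ?thesis using pos a by simp
      next
        case False
        then have b: "\<beta> = \<alpha> / \<delta>" using a by simp
        have "log (1 / \<delta>) (\<alpha>max / \<alpha>) = log (1 / \<delta>) (1 / \<delta> * (\<alpha>max / \<beta>))"
          using b \<delta> by simp
        also have "\<dots> = 1 + log (1 / \<delta>) (\<alpha>max / \<beta>)"
          using D a b \<delta> by (subst log_mult) auto
        finally have "\<lceil>log (1 / \<delta>) (\<alpha>max / \<alpha>)\<rceil> = 1 + \<lceil>log (1 / \<delta>) (\<alpha>max / \<beta>)\<rceil>" by linarith
        with pos show ?thesis by linarith
      qed
      then show ?thesis by (simp add: s)
    qed
  qed (use \<alpha>0 dec in auto)
  then show ?thesis
    unfolding expand_step_def by (auto simp: case_prod_beta)
qed

text \<open>Accepted steps are strictly positive, so \<open>\<alpha> = 0\<close> means that both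
  tests failed. The tested steps are \<open>min (z j) \<alpha>hat\<close> and
  \<open>min (z i) \<alpha>hat\<close>; the guards in the last two claims make them equal to
  \<open>\<alpha>hat\<close>.\<close>

lemma line_search_edge_dir:
  assumes z: "z \<in> standard_simplex (p - 1)" and ij: "i < p" "j < p" "i \<noteq> j"
    and \<delta>: "0 < \<delta>" "\<delta> < 1" and \<gamma>: "0 \<le> \<gamma>"
    and ls: "(\<alpha>, d) = line_search p \<phi> \<gamma> \<delta> z (edge_dir i j) \<alpha>hat"
  shows "move z \<alpha> d \<in> standard_simplex (p - 1)"
    and "\<phi> (move z \<alpha> d) \<le> \<phi> z"
    and "\<lbrakk>\<alpha> = 0; 0 < \<alpha>hat; \<alpha>hat \<le> z j\<rbrakk> \<Longrightarrow> \<not> sufficient_decrease \<phi> \<gamma> z \<alpha>hat (edge_dir i j)"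
    and "\<lbrakk>\<alpha> = 0; 0 < \<alpha>hat; \<alpha>hat \<le> z i\<rbrakk> \<Longrightarrow> \<not> sufficient_decrease \<phi> \<gamma> z \<alpha>hat (edge_dir j i)"
proof -
  have ji: "j \<noteq> i" using ij by simp
  have neg: "(\<lambda>h. - (basis_vec i h - basis_vec j h)) = edge_dir j i" by auto
  note ls' = ls[unfolded line_search_def neg max_step_edge_dir[OF z ij]
      max_step_edge_dir[OF z ij(2,1) ji] Let_def]
  have dec: "\<phi> (move z a e) \<le> \<phi> z" if "sufficient_decrease \<phi> \<gamma> z a e" for a e
    using that \<gamma> unfolding sufficient_decrease_def by (smt (verit) mult_nonneg_nonneg zero_le_power2)
  have nn: "0 \<le> z i" "0 \<le> z j"
    using z ij by (simp_all add: standard_simplex_def)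
  let ?P1 = "0 < min (z j) \<alpha>hat \<and> sufficient_decrease \<phi> \<gamma> z (min (z j) \<alpha>hat) (edge_dir i j)"
  let ?P2 = "0 < min (z i) \<alpha>hat \<and> sufficient_decrease \<phi> \<gamma> z (min (z i) \<alpha>hat) (edge_dir j i)"
  consider (1) ?P1 | (2) "\<not> ?P1" ?P2 | (3) "\<not> ?P1" "\<not> ?P2" by blast
  then have "move z \<alpha> d \<in> standard_simplex (p - 1) \<and> \<phi> (move z \<alpha> d) \<le> \<phi> z \<and>
    (\<alpha> = 0 \<longrightarrow> \<not> ?P1 \<and> \<not> ?P2)"
  proof cases
    case 1
    then have eq: "\<alpha> = expand_step \<phi> \<gamma> \<delta> z (edge_dir i j) (z j) (min (z j) \<alpha>hat)" "d = edge_dir i j"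
      using ls' by auto
    have *: "0 < \<alpha> \<and> \<alpha> \<le> z j \<and> sufficient_decrease \<phi> \<gamma> z \<alpha> d"
      unfolding eq by (rule expand_step_sound) (use 1 \<delta> in auto)
    then show ?thesis
      using dec move_edge_dir_in_simplex_iff[OF z ij, of \<alpha>] nn unfolding eq(2) by auto
  next
    case 2
    then have eq: "\<alpha> = expand_step \<phi> \<gamma> \<delta> z (edge_dir j i) (z i) (min (z i) \<alpha>hat)" "d = edge_dir j i"
      using ls' by auto
    have *: "0 < \<alpha> \<and> \<alpha> \<le> z i \<and> sufficient_decrease \<phi> \<gamma> z \<alpha> d"
      unfolding eq by (rule expand_step_sound) (use 2 \<delta> in auto)
    then show ?thesis
      using dec move_edge_dir_in_simplex_iff[OF z ij(2,1) ji, of \<alpha>] nn unfolding eq(2) by auto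
  next
    case 3
    then have "\<alpha> = 0" using ls' by (auto split: if_splits)
    then show ?thesis using 3 z by (simp add: move_def)
  qed
  then show "move z \<alpha> d \<in> standard_simplex (p - 1)"
    and "\<phi> (move z \<alpha> d) \<le> \<phi> z"
    and "\<lbrakk>\<alpha> = 0; 0 < \<alpha>hat; \<alpha>hat \<le> z j\<rbrakk> \<Longrightarrow> \<not> sufficient_decrease \<phi> \<gamma> z \<alpha>hat (edge_dir i j)"
    and "\<lbrakk>\<alpha> = 0; 0 < \<alpha>hat; \<alpha>hat \<le> z i\<rbrakk> \<Longrightarrow> \<not> sufficient_decrease \<phi> \<gamma> z \<alpha>hat (edge_dir j i)"
    by (auto simp: min_absorb2)
qed

section \<open>Descent and final state of DF-SIMPLEX\<close>

lemma df_simplex_iteration_descent: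
  assumes it: "df_simplex_iteration p \<phi> \<tau> \<theta> \<gamma> \<delta> \<epsilon> y \<alpha>hat j \<alpha> d z y' \<alpha>hat'"
    and y: "y \<in> standard_simplex (p - 1)"
    and \<delta>: "0 < \<delta>" "\<delta> < 1" and \<gamma>: "0 \<le> \<gamma>"
  shows "y' \<in> standard_simplex (p - 1) \<and> \<phi> y' \<le> \<phi> y"
proof -
  note it' = it[unfolded df_simplex_iteration_def]
  have j: "j < p" using it' by simp
  have "i \<le> p \<Longrightarrow> z i \<in> standard_simplex (p - 1) \<and> \<phi> (z i) \<le> \<phi> y" for i
  proof (induction i)
    case 0
    then show ?case using it' y by simp
  next
    case (Suc i)
    then have IH: "z i \<in> standard_simplex (p - 1)" "\<phi> (z i) \<le> \<phi> y" and i: "i < p" by auto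
    have zs: "z (Suc i) = move (z i) (\<alpha> i) (d i)" using it' i by auto
    show ?case
    proof (cases "i = j")
      case True
      then have "z (Suc i) = z i" using it' i by (auto simp: move_def)
      then show ?thesis using IH by simp
    next
      case False
      then have ls: "(\<alpha> i, d i) = line_search p \<phi> \<gamma> \<delta> (z i) (edge_dir i j) (\<alpha>hat i)"
        using it' i by auto
      show ?thesis
        using line_search_edge_dir(1,2)[OF IH(1) i j False \<delta> \<gamma> ls] IH(2) unfolding zs by auto
    qed
  qed
  then show ?thesis using it' by simp
qed

text \<open>In a stopping iteration every step is zero, so all intermediate points equal
  \<open>y\<close>; hence all the failed tests concern the same point and the same step
  \<open>\<epsilon>\<close>.\<close>

lemma df_simplex_iteration_stop:
  assumes it: "df_simplex_iteration p \<phi> \<tau> \<theta> \<gamma> \<delta> \<epsilon> y \<alpha>hat j \<alpha> d z y' \<alpha>hat'"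
    and stop: "df_simplex_stops p \<epsilon> \<alpha>hat j \<alpha>"
    and y: "y \<in> standard_simplex (p - 1)" and \<epsilon>: "0 < \<epsilon>"
    and \<delta>: "0 < \<delta>" "\<delta> < 1" and \<gamma>: "0 \<le> \<gamma>" and i: "i < p" "i \<noteq> j"
  shows "\<epsilon> \<le> y j \<Longrightarrow> \<not> sufficient_decrease \<phi> \<gamma> y \<epsilon> (edge_dir i j)"
    and "\<epsilon> \<le> y i \<Longrightarrow> \<not> sufficient_decrease \<phi> \<gamma> y \<epsilon> (edge_dir j i)"
proof -
  note it' = it[unfolded df_simplex_iteration_def]
  note stop' = stop[unfolded df_simplex_stops_def]
  have j: "j < p" using it' by simp
  have "h \<le> p \<Longrightarrow> z h = y" for h
  proof (induction h)
    case (Suc h)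
    then have "\<alpha> h = 0" using it' stop' by (metis Suc_le_lessD)
    then show ?case using it' Suc by (auto simp: move_def)
  qed (use it' in auto)
  then have zi: "z i = y" using i by simp
  have "(\<alpha> i, d i) = line_search p \<phi> \<gamma> \<delta> y (edge_dir i j) \<epsilon>"
    using it' stop' i zi by auto
  moreover have "\<alpha> i = 0" using stop' i by simp
  ultimately show "\<epsilon> \<le> y j \<Longrightarrow> \<not> sufficient_decrease \<phi> \<gamma> y \<epsilon> (edge_dir i j)"
    and "\<epsilon> \<le> y i \<Longrightarrow> \<not> sufficient_decrease \<phi> \<gamma> y \<epsilon> (edge_dir j i)"
    using line_search_edge_dir(3,4)[OF y i(1) j i(2) \<delta> \<gamma>] \<epsilon> by auto
qed

text \<open>What a finished run leaves behind, with the run itself forgotten: the pivot rule,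
  coordinate by coordinate, and the failed tests. The pivot \<open>j\<close> is a parameter so that
  it can be held constant along a subsequence.\<close>

definition approx_stationary ::
  "nat \<Rightarrow> (coords \<Rightarrow> real) \<Rightarrow> real \<Rightarrow> real \<Rightarrow> real \<Rightarrow> coords \<Rightarrow> nat \<Rightarrow> bool" where
  "approx_stationary p \<phi> \<tau> \<gamma> \<epsilon> y j \<longleftrightarrow>
     j < p \<and> (\<forall>i<p. \<tau> * y i \<le> y j) \<and>
     (\<forall>i<p. i \<noteq> j \<longrightarrow>
       (\<epsilon> \<le> y j \<longrightarrow> \<not> sufficient_decrease \<phi> \<gamma> y \<epsilon> (edge_dir i j)) \<and>
       (\<epsilon> \<le> y i \<longrightarrow> \<not> sufficient_decrease \<phi> \<gamma> y \<epsilon> (edge_dir j i)))"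

lemma df_simplex_result:
  assumes df: "df_simplex p \<phi> \<tau> \<theta> \<gamma> \<delta> \<epsilon> y0 ybar"
    and p: "0 < p" and y0: "y0 \<in> standard_simplex (p - 1)" and \<epsilon>: "0 < \<epsilon>"
    and \<tau>: "0 < \<tau>" "\<tau> \<le> 1" and \<delta>: "0 < \<delta>" "\<delta> < 1" and \<gamma>: "0 \<le> \<gamma>"
  shows "ybar \<in> standard_simplex (p - 1)" and "\<phi> ybar \<le> \<phi> y0"
    and "\<exists>j. approx_stationary p \<phi> \<tau> \<gamma> \<epsilon> ybar j"
proof -
  have "ybar \<in> standard_simplex (p - 1) \<and> \<phi> ybar \<le> \<phi> y0 \<and> (\<exists>j. approx_stationary p \<phi> \<tau> \<gamma> \<epsilon> ybar j)"
  proof (cases "p = 1")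
    case True
    \<comment> \<open>With one coordinate the pivot is 0 and there are no edges; the pivot rule
      reduces to this inequality.\<close>
    have "\<tau> * y0 0 \<le> y0 0"
      using y0 \<tau> by (intro mult_left_le_one_le) (auto simp: standard_simplex_def)
    then show ?thesis
      using df y0 True by (auto simp: df_simplex_def approx_stationary_def)
  next
    case False
    then obtain y \<alpha>hat j \<alpha> d z L where y: "y 0 = y0"
      and it: "\<And>l. l \<le> L \<Longrightarrow> df_simplex_iteration p \<phi> \<tau> \<theta> \<gamma> \<delta> \<epsilon> (y l) (\<alpha>hat l) (j l) (\<alpha> l) (d l) (z l)
                 (y (Suc l)) (\<alpha>hat (Suc l))"
      and stop: "df_simplex_stops p \<epsilon> (\<alpha>hat L) (j L) (\<alpha> L)" and L: "ybar = y L"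
      using df unfolding df_simplex_def by (simp only: if_False) blast
    have "l \<le> L \<Longrightarrow> y l \<in> standard_simplex (p - 1) \<and> \<phi> (y l) \<le> \<phi> y0" for l
    proof (induction l)
      case (Suc l)
      then show ?case
        using df_simplex_iteration_descent[OF it[of l] _ \<delta> \<gamma>] by force
    qed (use y y0 in auto)
    then have yL: "ybar \<in> standard_simplex (p - 1)" "\<phi> ybar \<le> \<phi> y0" unfolding L by auto
    \<comment> \<open>The stopping iteration \<open>L\<close> is itself executed from
      \<open>y L\<close>, so its pivot rule speaks about the returned point.\<close>
    have j: "j L < p" "\<tau> * Max (ybar ` {..<p}) \<le> ybar (j L)"
      using it[of L] unfolding df_simplex_iteration_def L by auto
    have "\<tau> * ybar i \<le> ybar (j L)" if "i < p" for i
    proof -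
      have "ybar i \<le> Max (ybar ` {..<p})" using that by (intro Max_ge) auto
      then show ?thesis using j(2) \<tau>(1) by (meson mult_left_mono order_trans less_imp_le)
    qed
    then have "approx_stationary p \<phi> \<tau> \<gamma> \<epsilon> ybar (j L)"
      using j(1) df_simplex_iteration_stop[OF it[OF order_refl] stop _ \<epsilon> \<delta> \<gamma>] yL(1)
      unfolding approx_stationary_def L by blast
    then show ?thesis using yL by blast
  qed
  then show "ybar \<in> standard_simplex (p - 1)" and "\<phi> ybar \<le> \<phi> y0"
    and "\<exists>j. approx_stationary p \<phi> \<tau> \<gamma> \<epsilon> ybar j" by auto
qed

section \<open>From coordinates to points of the convex hull\<close>

lemma mat_apply_move: "mat_apply as (move y t d) = mat_apply as y + t *\<^sub>R mat_apply as d"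
  by (simp add: mat_apply_def move_def sum.distrib scaleR_left_distrib scaleR_right.sum)

lemma mat_apply_basis_vec: "i < length as \<Longrightarrow> mat_apply as (basis_vec i) = as ! i"
  unfolding mat_apply_def basis_vec_def
  by (simp add: if_distrib[where f = "\<lambda>c. c *\<^sub>R _"] sum.delta cong: if_cong)

lemma mat_apply_edge_dir:
  "i < length as \<Longrightarrow> j < length as \<Longrightarrow> mat_apply as (edge_dir i j) = as ! i - as ! j"
  by (simp add: mat_apply_basis_vec[symmetric])
    (simp add: mat_apply_def scaleR_left_diff_distrib sum_subtractf)

lemma mat_apply_in_convex_hull:
  assumes "as \<noteq> []" and "y \<in> standard_simplex (length as - 1)" and "set as \<subseteq> A"
  shows "mat_apply as y \<in> convex hull A"
proof -
  have "0 < length as" using assms by simp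
  note y = assms(2)[unfolded standard_simplex_iff[OF this]]
  show ?thesis
    unfolding mat_apply_def
    by (rule convex_sum) (use y assms(3) in \<open>auto intro!: hull_inc simp: subset_iff\<close>)
qed

section \<open>First-order conditions in the limit\<close>

text \<open>By the mean value theorem, the failed decrease divided by \<open>t n\<close> bounds a
  derivative at an intermediate point below by \<open>- c * t n\<close>; this point tends to
  \<open>u0\<close>. The direction may vary with \<open>n\<close>, as it does in the refine
  test.\<close>

lemma limit_directional_derivative_nonneg:
  fixes f :: "'a::real_inner \<Rightarrow> real"
  assumes deriv: "\<And>x. GDERIV f x :> g x" and cont: "continuous_on UNIV g"
    and u: "u \<longlonglongrightarrow> u0" and v: "v \<longlonglongrightarrow> v0" and t: "t \<longlonglongrightarrow> 0"
    and pos: "eventually (\<lambda>n. 0 < t n) sequentially"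
    and ge: "eventually (\<lambda>n. f (u n) - c * (t n)\<^sup>2 \<le> f (u n + t n *\<^sub>R v n)) sequentially"
  shows "0 \<le> g u0 \<bullet> v0"
proof -
  \<comment> \<open>The intermediate point is written as \<open>u n\<close> plus a fraction
    \<open>s\<close> of the step, so that \<open>t n -> 0\<close> forces its convergence.\<close>
  have "\<exists>s. 0 \<le> s \<and> s \<le> 1 \<and> f (u n + t n *\<^sub>R v n) - f (u n) = t n * (g (u n + (s * t n) *\<^sub>R v n) \<bullet> v n)"
    for n
  proof -
    let ?h = "\<lambda>s. f (u n + (s * t n) *\<^sub>R v n)"
    have "(?h has_derivative (\<lambda>r. r * (t n * (g (u n + (s * t n) *\<^sub>R v n) \<bullet> v n)))) (at s within {0..1})" for s
    proof -
      have "(f has_derivative (\<lambda>h. h \<bullet> g (u n + (s * t n) *\<^sub>R v n))) (at (u n + (s * t n) *\<^sub>R v n))"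
        using deriv by (simp add: gderiv_def)
      moreover have "((\<lambda>s. u n + (s * t n) *\<^sub>R v n) has_derivative (\<lambda>r. (r * t n) *\<^sub>R v n)) (at s within {0..1})"
        by (auto intro!: derivative_eq_intros)
      ultimately have "(?h has_derivative (\<lambda>r. (r * t n) *\<^sub>R v n \<bullet> g (u n + (s * t n) *\<^sub>R v n))) (at s within {0..1})"
        using has_derivative_compose by fast
      then show ?thesis
        by (simp add: inner_commute mult_ac)
    qed
    from mvt_simple[OF zero_less_one this]
    obtain s where "s \<in> {0<..<1}" "?h 1 - ?h 0 = (1 - 0) * (t n * (g (u n + (s * t n) *\<^sub>R v n) \<bullet> v n))"
      by blast
    then show ?thesis by (intro exI[of _ s]) auto
  qed
  then obtain s where s: "\<And>n. 0 \<le> s n" "\<And>n. s n \<le> 1"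
    and eq: "\<And>n. f (u n + t n *\<^sub>R v n) - f (u n) = t n * (g (u n + (s n * t n) *\<^sub>R v n) \<bullet> v n)"
    by metis
  have "(\<lambda>n. s n * t n) \<longlonglongrightarrow> 0"
  proof (rule tendsto_rabs_zero_cancel, rule tendsto_sandwich[of "\<lambda>_. 0" _ _ "\<lambda>n. \<bar>t n\<bar>"])
    show "(\<lambda>n. \<bar>t n\<bar>) \<longlonglongrightarrow> 0" using t by (rule tendsto_rabs_zero)
    show "\<forall>\<^sub>F n in sequentially. \<bar>s n * t n\<bar> \<le> \<bar>t n\<bar>"
      using s by (auto simp: abs_mult intro!: always_eventually mult_left_le_one_le)
  qed auto
  then have "(\<lambda>n. u n + (s n * t n) *\<^sub>R v n) \<longlonglongrightarrow> u0 + 0 *\<^sub>R v0"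
    by (intro tendsto_intros u v)
  then have "(\<lambda>n. u n + (s n * t n) *\<^sub>R v n) \<longlonglongrightarrow> u0" by simp
  then have "(\<lambda>n. g (u n + (s n * t n) *\<^sub>R v n)) \<longlonglongrightarrow> g u0"
    using continuous_on_tendsto_compose[OF cont] by simp
  then have lim: "(\<lambda>n. g (u n + (s n * t n) *\<^sub>R v n) \<bullet> v n + c * t n) \<longlonglongrightarrow> g u0 \<bullet> v0 + c * 0"
    by (intro tendsto_intros v t)
  have "eventually (\<lambda>n. 0 \<le> g (u n + (s n * t n) *\<^sub>R v n) \<bullet> v n + c * t n) sequentially"
    using pos ge
  proof eventually_elim
    case (elim n)
    then have "0 \<le> t n * (g (u n + (s n * t n) *\<^sub>R v n) \<bullet> v n + c * t n)"
      using eq[of n] by (simp add: algebra_simps power2_eq_square)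
    then show ?case using elim by (simp add: zero_le_mult_iff)
  qed
  from tendsto_lowerbound[OF lim this] show ?thesis by simp
qed

text \<open>The edge conditions compare atoms with the pivot atom. Averaging them with the limit
  weights shows that the gradient takes the same value at the pivot atom and at the limit point, so
  they become conditions at the limit point.\<close>

lemma stationary_limit:
  fixes f :: "'a::real_inner \<Rightarrow> real"
  assumes deriv: "\<And>x. GDERIV f x :> g x" and cont: "continuous_on UNIV g"
    and as: "as \<noteq> []" "set as \<subseteq> A" and \<tau>: "0 < \<tau>"
    and Y: "\<And>n. Y n \<in> standard_simplex (length as - 1)"
    and approx: "\<And>n. approx_stationary (length as) (\<lambda>v. f (mat_apply as v)) \<tau> \<gamma> (e n) (Y n) j"
    and e: "\<And>n. 0 < e n" "e \<longlonglongrightarrow> 0"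
    and lim: "\<And>h. (\<lambda>n. Y n h) \<longlonglongrightarrow> ys h"
    and \<mu>: "\<And>n. 0 < \<mu> n" "\<mu> \<longlonglongrightarrow> 0"
    and other: "\<And>a n. a \<in> A - set as \<Longrightarrow>
      f (mat_apply as (Y n)) - \<gamma>' * (\<mu> n)\<^sup>2
        \<le> f (mat_apply as (Y n) + \<mu> n *\<^sub>R (a - mat_apply as (Y n)))"
  shows "(\<lambda>n. mat_apply as (Y n)) \<longlonglongrightarrow> mat_apply as ys"
    and "stationary_point f (convex hull A) (mat_apply as ys)"
proof -
  let ?p = "length as" and ?x = "mat_apply as ys"
  have p: "0 < ?p" using as by simp
  note Y' = Y[unfolded standard_simplex_iff[OF p]]
  note ap = approx[unfolded approx_stationary_def]
  have j: "j < ?p" using ap by blast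
  show limx: "(\<lambda>n. mat_apply as (Y n)) \<longlonglongrightarrow> ?x"
    unfolding mat_apply_def by (intro tendsto_intros lim)
  have nn: "0 \<le> ys h" for h
    using LIMSEQ_le_const[OF lim[of h]] Y' by blast
  have "(\<lambda>n. Y n h) \<longlonglongrightarrow> 0" if "?p \<le> h" for h
    using Y' that by simp
  then have out: "ys h = 0" if "?p \<le> h" for h
    using LIMSEQ_unique[OF lim[of h]] that by blast
  have "(\<lambda>n. \<Sum>h<?p. Y n h) \<longlonglongrightarrow> (\<Sum>h<?p. ys h)"
    by (intro tendsto_intros lim)
  then have sum1: "(\<Sum>h<?p. ys h) = 1"
    using Y' LIMSEQ_unique[of "\<lambda>_. 1::real"] by simp
  have ys: "ys \<in> standard_simplex (?p - 1)"
    unfolding standard_simplex_iff[OF p] using nn out sum1 by blast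
  have \<tau>le: "\<tau> * ys i \<le> ys j" if "i < ?p" for i
    by (rule LIMSEQ_le[of "\<lambda>n. \<tau> * Y n i" _ "\<lambda>n. Y n j"]) (use ap that in \<open>auto intro!: tendsto_intros lim\<close>)
  \<comment> \<open>If the pivot weight vanished in the limit, the pivot rule would make every
    weight vanish, against total weight 1.\<close>
  have posj: "0 < ys j"
  proof (rule ccontr)
    assume "\<not> 0 < ys j"
    then have "\<tau> * ys i \<le> 0" if "i < ?p" for i using \<tau>le[OF that] by simp
    then have "ys i = 0" if "i < ?p" for i
      using \<tau> nn[of i] that by (simp add: mult_le_0_iff antisym)
    then show False using sum1 by simp
  qed
  \<comment> \<open>A weight with positive limit eventually exceeds the vanishing tolerance, which
    discharges the guards of \<open>approx_stationary\<close>.\<close>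
  have small: "\<forall>\<^sub>F n in sequentially. e n \<le> Y n i" if "0 < ys i" for i
  proof -
    have "(\<lambda>n. Y n i - e n) \<longlonglongrightarrow> ys i - 0" by (intro tendsto_intros lim e)
    then have "\<forall>\<^sub>F n in sequentially. 0 < Y n i - e n"
      using that by (intro order_tendstoD) auto
    then show ?thesis by (rule eventually_mono) simp
  qed
  have edge: "0 \<le> g ?x \<bullet> (as ! i - as ! h)"
    if ih: "i < ?p" "h < ?p"
      and ev: "\<forall>\<^sub>F n in sequentially.
        \<not> sufficient_decrease (\<lambda>v. f (mat_apply as v)) \<gamma> (Y n) (e n) (edge_dir i h)" for i h
  proof (rule limit_directional_derivative_nonneg[OF deriv cont limx tendsto_const e(2)])
    show "\<forall>\<^sub>F n in sequentially. 0 < e n" using e by simp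
    show "\<forall>\<^sub>F n in sequentially.
        f (mat_apply as (Y n)) - \<gamma> * (e n)\<^sup>2 \<le> f (mat_apply as (Y n) + e n *\<^sub>R (as ! i - as ! h))"
      using ev
      by eventually_elim (simp add: sufficient_decrease_def mat_apply_move mat_apply_edge_dir ih)
  qed
  have ge: "0 \<le> g ?x \<bullet> (as ! i - as ! j)" if "i < ?p" for i
  proof (cases "i = j")
    case False
    show ?thesis
      by (rule edge[OF that j], rule eventually_mono[OF small[OF posj]]) (use ap that False in blast)
  qed simp
  have le: "0 \<le> g ?x \<bullet> (as ! j - as ! i)" if "i < ?p" "0 < ys i" for i
  proof (cases "i = j")
    case False
    show ?thesis
      by (rule edge[OF j that(1)], rule eventually_mono[OF small[OF that(2)]]) (use ap that False in blast)
  qed simp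
  \<comment> \<open>Complementarity: either the weight is zero, or both edge inequalities hold and
    give equality.\<close>
  have "ys i * (g ?x \<bullet> (as ! i)) = ys i * (g ?x \<bullet> (as ! j))" if "i < ?p" for i
    using ge[OF that] le[OF that] nn[of i] by (cases "ys i = 0") (auto simp: inner_diff_right)
  then have "(\<Sum>i<?p. ys i * (g ?x \<bullet> (as ! i))) = (\<Sum>i<?p. ys i * (g ?x \<bullet> (as ! j)))"
    by (intro sum.cong) auto
  also have "\<dots> = g ?x \<bullet> (as ! j)"
    using sum1 by (simp flip: sum_distrib_right)
  finally have "(\<Sum>i<?p. ys i * (g ?x \<bullet> (as ! i))) = g ?x \<bullet> (as ! j)" .
  moreover have "w \<bullet> ?x = (\<Sum>i<?p. ys i * (w \<bullet> (as ! i)))" for w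
    by (simp add: mat_apply_def inner_sum_right)
  ultimately have eq: "g ?x \<bullet> ?x = g ?x \<bullet> (as ! j)"
    by (rule trans[rotated])
  have "0 \<le> g ?x \<bullet> (a - ?x)" if "a \<in> A" for a
  proof (cases "a \<in> set as")
    case True
    then obtain i where "i < ?p" "a = as ! i" by (auto simp: in_set_conv_nth)
    then show ?thesis using ge[of i] eq by (simp add: inner_diff_right)
  next
    case False
    show ?thesis
    proof (rule limit_directional_derivative_nonneg[OF deriv cont limx _ \<mu>(2), where c = \<gamma>'])
      show "(\<lambda>n. a - mat_apply as (Y n)) \<longlonglongrightarrow> a - ?x" by (intro tendsto_intros limx)
    qed (use \<mu> other that False in auto)
  qed
  \<comment> \<open>Passing from atoms to the whole hull: a half-space is convex.\<close>
  then have "A \<subseteq> {y. g ?x \<bullet> ?x \<le> g ?x \<bullet> y}" by (auto simp: inner_diff_right)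
  then have "convex hull A \<subseteq> {y. g ?x \<bullet> ?x \<le> g ?x \<bullet> y}"
    using convex_halfspace_ge[where b = "g ?x \<bullet> ?x" and a = "g ?x"] by (intro hull_minimal) simp_all
  then show "stationary_point f (convex hull A) ?x"
    unfolding stationary_point_def
    using deriv mat_apply_in_convex_hull[OF as(1) ys as(2)]
    by (auto simp: inner_diff_right)
qed

section \<open>Convergence of the ORD iterates\<close>

theorem theorem3:
  fixes A :: "(real ^ 'n) set" and f :: "real ^ 'n \<Rightarrow> real"
    and \<tau> \<theta> \<gamma> \<delta> \<theta>ord \<gamma>ord \<mu>0 :: real
    and \<epsilon> :: "nat \<Rightarrow> real" and x :: "nat \<Rightarrow> real ^ 'n"
  assumes "finite A" and "A \<noteq> {}"
    and "continuously_differentiable f"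
    and "0 < \<tau>" and "\<tau> \<le> 1" and "0 < \<theta>" and "\<theta> < 1" and "0 < \<gamma>" and "0 < \<delta>" and "\<delta> < 1"
    and "0 < \<theta>ord" and "\<theta>ord < 1" and "0 < \<gamma>ord" and "0 < \<mu>0" and "\<mu>0 < 1"
    and "\<And>k. 0 < \<epsilon> k" and "decseq \<epsilon>" and "\<epsilon> \<longlonglongrightarrow> 0"
    and "ord_sequence f A \<tau> \<theta> \<gamma> \<delta> \<theta>ord \<gamma>ord \<epsilon> \<mu>0 x"
  shows "\<exists>xstar r. strict_mono r \<and> (x \<circ> r) \<longlonglongrightarrow> xstar \<and>
           stationary_point f (convex hull A) xstar"
proof -
  obtain g where deriv: "\<And>x. GDERIV f x :> g x" and contg: "continuous_on UNIV g"
    using assms(3) unfolding continuously_differentiable_def by auto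
  obtain as y \<mu>hat ybar xbar R where
    init: "distinct (as 0)" "set (as 0) \<subseteq> A"
      "\<exists>h<length (as 0). x 0 = as 0 ! h \<and> y 0 = basis_vec h"
    and \<mu>hat0: "\<mu>hat 0 = \<mu>0"
    and opt: "\<And>k. optimize_phase f \<tau> \<theta> \<gamma> \<delta> (\<epsilon> k) (as k) (y k) (ybar k) (xbar k)"
    and refine: "\<And>k. refine_phase f A \<theta>ord \<gamma>ord (set (as k)) (xbar k) (\<mu>hat k)
             (x (Suc k)) (R k) (\<mu>hat (Suc k))"
    and dropk: "\<And>k. drop_phase (as k) (ybar k) (R k) (x (Suc k)) (as (Suc k)) (y (Suc k))"
    using assms(19) unfolding ord_sequence_def by (elim exE conjE, blast)

  \<comment> \<open>Invariant of the outer loop; its delicate part is that the working list never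
    becomes empty.\<close>
  define ok where "ok k \<longleftrightarrow> distinct (as k) \<and> set (as k) \<subseteq> A \<and> as k \<noteq> [] \<and>
    y k \<in> standard_simplex (length (as k) - 1) \<and> x k = mat_apply (as k) (y k)" for k
  define \<phi> where "\<phi> k v = f (mat_apply (as k) v)" for k v
  have df: "df_simplex (length (as k)) (\<phi> k) \<tau> \<theta> \<gamma> \<delta> (\<epsilon> k) (y k) (ybar k)"
    and xbar: "xbar k = mat_apply (as k) (ybar k)" for k
    using opt[of k] by (auto simp: optimize_phase_def \<phi>_def[abs_def])
  have inner: "ybar k \<in> standard_simplex (length (as k) - 1)" "f (xbar k) \<le> f (x k)"
    "\<exists>j. approx_stationary (length (as k)) (\<phi> k) \<tau> \<gamma> (\<epsilon> k) (ybar k) j" if "ok k" for k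
  proof -
    have *: "0 < length (as k)" "y k \<in> standard_simplex (length (as k) - 1)"
      using that unfolding ok_def by auto
    note res = df_simplex_result[OF df[of k] * assms(16,4,5,9,10) less_imp_le[OF assms(8)]]
    show "ybar k \<in> standard_simplex (length (as k) - 1)" "f (xbar k) \<le> f (x k)"
      "\<exists>j. approx_stationary (length (as k)) (\<phi> k) \<tau> \<gamma> (\<epsilon> k) (ybar k) j"
      using res that by (auto simp: xbar ok_def \<phi>_def)
  qed
  have ok: "ok k" for k
  proof (induction k)
    case 0
    obtain h where h: "h < length (as 0)" "x 0 = as 0 ! h" "y 0 = basis_vec h"
      using init by blast
    then have p: "0 < length (as 0)" by linarith
    have "y 0 \<in> standard_simplex (length (as 0) - 1)"
      unfolding standard_simplex_iff[OF p] h(3) using h(1) sum_basis_vec[OF h(1)]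
      by (auto simp: basis_vec_def)
    moreover have "as 0 \<noteq> []" using p by (rule length_greater_0_conv[THEN iffD1])
    ultimately show ?case using init h by (simp add: ok_def mat_apply_basis_vec)
  next
    case (Suc k)
    have p: "0 < length (as k)" using Suc by (simp add: ok_def)
    obtain D where D: "D \<subseteq> {as k ! h | h. h < length (as k) \<and> ybar k h = 0}"
      "distinct (as (Suc k))" "set (as (Suc k)) = (set (as k) \<union> R k) - D"
      "y (Suc k) \<in> standard_simplex (length (as (Suc k)) - 1)"
      "x (Suc k) = mat_apply (as (Suc k)) (y (Suc k))"
      using dropk[of k] unfolding drop_phase_def by blast
    have R: "R k \<subseteq> A"
      using refine[of k] unfolding refine_phase_def refine_success_def by (auto split: if_splits)
    \<comment> \<open>Some atom has nonzero weight. Since the list is distinct, the atom cannot be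
      dropped through another index of weight zero, so it survives.\<close>
    have "(\<Sum>h<length (as k). ybar k h) = 1"
      using inner(1)[OF Suc] standard_simplex_iff[OF p] by blast
    then obtain h where h: "h < length (as k)" "ybar k h \<noteq> 0"
      by (metis lessThan_iff sum.neutral zero_neq_one)
    then have "as k ! h \<notin> D"
      using D(1) Suc by (auto simp: ok_def nth_eq_iff_index_eq)
    then have "as (Suc k) \<noteq> []" using D(3) h(1) by (metis Diff_iff UnI1 empty_iff list.set(1) nth_mem)
    then show ?case using D R Suc by (auto simp: ok_def)
  qed
  note inner = inner[OF ok]

  \<comment> \<open>The iterations whose refine phase fails.\<close>
  define S where "S = {k. \<not> (\<exists>a \<mu>. refine_success f A \<gamma>ord (set (as k)) (xbar k) (\<mu>hat k) a \<mu>)}"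
  have fail: "x (Suc k) = xbar k" "\<mu>hat (Suc k) = \<theta>ord * \<mu>hat k" if "k \<in> S" for k
    using refine[of k] that by (auto simp: refine_phase_def S_def split: if_splits)
  have succ: "\<mu>hat (Suc k) = \<mu>hat k \<and> (\<exists>\<mu>\<ge>\<mu>hat k. f (x (Suc k)) \<le> f (xbar k) - \<gamma>ord * \<mu>\<^sup>2)"
    if "k \<notin> S" for k
    using refine[of k] that unfolding refine_phase_def S_def refine_success_def
    by (auto split: if_splits)
  have \<mu>pos: "0 < \<mu>hat k" for k
  proof (induction k)
    case (Suc k)
    then show ?case using fail(2)[of k] succ[of k] assms(11) by (cases "k \<in> S") auto
  qed (use \<mu>hat0 assms in simp)
  have "\<mu>hat (Suc k) \<le> \<mu>hat k" for k
    using fail(2)[of k] succ[of k] \<mu>pos[of k] assms(12) by (cases "k \<in> S") auto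
  then have "decseq \<mu>hat" by (rule decseq_SucI)
  \<comment> \<open>The limit exists by monotonicity; that it is 0 follows later from the
    failures.\<close>
  then obtain M where M: "\<mu>hat \<longlonglongrightarrow> M"
    using decseq_convergent[of \<mu>hat 0] \<mu>pos by (metis less_imp_le)

  have xA: "x k \<in> convex hull A" for k
    using ok[of k] mat_apply_in_convex_hull unfolding ok_def by metis
  have "continuous_on UNIV f"
    using deriv by (meson GDERIV_DERIV_compose continuous_at_imp_continuous_on gderiv_def has_derivative_continuous)
  then have "compact (f ` (convex hull A))"
    using assms(1) by (intro compact_continuous_image finite_imp_compact_convex_hull)
      (auto intro: continuous_on_subset)
  then obtain B where B: "\<And>k. B \<le> f (x k)"
    using xA bounded_imp_bdd_below[OF compact_imp_bounded] by (metis bdd_below.E imageI)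
  have succ_dec: "f (x (Suc k)) \<le> f (x k) - \<gamma>ord * (\<mu>hat k)\<^sup>2" if k: "k \<notin> S" for k
  proof -
    obtain \<mu> where \<mu>: "\<mu>hat k \<le> \<mu>" "f (x (Suc k)) \<le> f (xbar k) - \<gamma>ord * \<mu>\<^sup>2"
      using succ[OF k] by blast
    have "\<gamma>ord * (\<mu>hat k)\<^sup>2 \<le> \<gamma>ord * \<mu>\<^sup>2"
      using \<mu>(1) \<mu>pos[of k] assms(13) by (intro mult_left_mono power_mono) auto
    then show ?thesis using \<mu>(2) inner(2)[of k] by linarith
  qed
  \<comment> \<open>After a last failure \<open>\<mu>hat\<close> would stay constant, and
    \<open>f\<close> would drop by at least a fixed positive amount per iteration, below
    \<open>B\<close>.\<close>
  have "infinite S"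
  proof
    assume "finite S"
    then obtain N where N: "\<And>k. N \<le> k \<Longrightarrow> k \<notin> S"
      by (metis finite_nat_set_iff_bounded not_less)
    have c: "0 < \<gamma>ord * (\<mu>hat N)\<^sup>2" using assms(13) \<mu>pos[of N] by simp
    have "\<mu>hat (N + n) = \<mu>hat N \<and> f (x (N + n)) \<le> f (x N) - of_nat n * (\<gamma>ord * (\<mu>hat N)\<^sup>2)" for n
    proof (induction n)
      case (Suc n)
      then show ?case
        using succ[OF N[of "N + n"]] succ_dec[OF N[of "N + n"]] by (auto simp: algebra_simps)
    qed simp
    moreover obtain n where "f (x N) - B < of_nat n * (\<gamma>ord * (\<mu>hat N)\<^sup>2)"
      using reals_Archimedean3[OF c] by blast
    ultimately show False using B[of "N + n"] by (smt (verit))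
  qed

  obtain j where approx: "\<And>k. approx_stationary (length (as k)) (\<phi> k) \<tau> \<gamma> (\<epsilon> k) (ybar k) (j k)"
    using inner(3) by metis
  \<comment> \<open>Fixing the list, and not just its set of atoms, also fixes the order of the
    columns, so coordinates are comparable along the subsequence. Only finitely many pairs
    occur.\<close>
  define F where "F k = (as k, j k)" for k
  have "F ` S \<subseteq> {xs. distinct xs \<and> set xs \<subseteq> A} \<times> {..<card A}"
  proof
    fix w assume "w \<in> F ` S"
    then obtain k where w: "w = (as k, j k)" unfolding F_def by blast
    have "length (as k) \<le> card A"
      using ok[of k] card_mono[OF assms(1), of "set (as k)"] by (auto simp: ok_def distinct_card)
    then show "w \<in> {xs. distinct xs \<and> set xs \<subseteq> A} \<times> {..<card A}"
      using approx[of k] ok[of k] by (auto simp: w approx_stationary_def ok_def)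
  qed
  moreover have "finite {xs. distinct xs \<and> set xs \<subseteq> A}"
    using finite_subset_distinct[OF assms(1)] by (simp add: conj_commute)
  ultimately have "finite (F ` S)"
    by (meson finite_SigmaI finite_lessThan finite_subset)
  from pigeonhole_infinite[OF \<open>infinite S\<close> this] obtain k0 where
    "infinite {k \<in> S. F k = F k0}" by blast
  then obtain r0 :: "nat \<Rightarrow> nat" where r0: "strict_mono r0" "\<And>n. r0 n \<in> S" "\<And>n. F (r0 n) = F k0"
    using infinite_enumerate by (metis (mono_tags, lifting) mem_Collect_eq)
  have bnd: "norm (ybar (r0 n) h) \<le> 1" for n h
    using inner(1)[of "r0 n"] by (simp add: standard_simplex_def)
  \<comment> \<open>Coordinate vectors are functions on \<open>nat\<close>; a diagonal extraction
    makes all coordinates converge along one subsequence.\<close>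
  obtain r1 :: "nat \<Rightarrow> nat" where r1: "strict_mono r1"
    "\<And>h. \<exists>l. (\<lambda>n. ybar (r0 (r1 n)) h) \<longlonglongrightarrow> l"
    by (rule function_convergent_subsequence[of UNIV "\<lambda>n. ybar (r0 n)" 1]) (use bnd in auto)
  then obtain ys where ys: "\<And>h. (\<lambda>n. ybar (r0 (r1 n)) h) \<longlonglongrightarrow> ys h" by metis
  define r where "r = r0 \<circ> r1"
  have r: "strict_mono r" unfolding r_def using r0(1) r1(1) by (rule strict_mono_o)
  have rS: "r n \<in> S" and asr: "as (r n) = as k0" and jr: "j (r n) = j k0" for n
    using r0(2,3)[of "r1 n"] by (auto simp: r_def F_def)
  \<comment> \<open>Along failures the next trial step is \<open>\<theta>ord\<close> times the
    current one, so \<open>M = \<theta>ord * M\<close>, and \<open>\<theta>ord < 1\<close> leaves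
    \<open>M = 0\<close>.\<close>
  have "(\<lambda>n. \<mu>hat (Suc (r n))) \<longlonglongrightarrow> M"
    using LIMSEQ_subseq_LIMSEQ[OF M, of "Suc \<circ> r"] r by (simp add: o_def strict_mono_Suc_iff strict_mono_def)
  moreover have lim\<mu>: "(\<lambda>n. \<mu>hat (r n)) \<longlonglongrightarrow> M"
    using LIMSEQ_subseq_LIMSEQ[OF M r] by (simp add: o_def)
  then have "(\<lambda>n. \<theta>ord * \<mu>hat (r n)) \<longlonglongrightarrow> \<theta>ord * M" by (rule tendsto_mult_left)
  ultimately have "M = \<theta>ord * M" unfolding fail(2)[OF rS] by (rule LIMSEQ_unique)
  then have M0: "M = 0" using assms(12) by simp
  have lim\<epsilon>: "(\<lambda>n. \<epsilon> (r n)) \<longlonglongrightarrow> 0"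
    using LIMSEQ_subseq_LIMSEQ[OF assms(18) r] by (simp add: o_def)
  have k0: "as k0 \<noteq> []" "set (as k0) \<subseteq> A" using ok[of k0] by (auto simp: ok_def)
  have other: "f (mat_apply (as k0) (ybar (r n))) - \<gamma>ord * (\<mu>hat (r n))\<^sup>2
      \<le> f (mat_apply (as k0) (ybar (r n)) + \<mu>hat (r n) *\<^sub>R (a - mat_apply (as k0) (ybar (r n))))"
    if "a \<in> A - set (as k0)" for a n
  proof -
    \<comment> \<open>This makes \<open>\<mu>hat (r n)\<close> itself one of the steps rejected by
      the failed refine test.\<close>
    have "\<mu>hat (r n) \<le> 1"
      using \<open>decseq \<mu>hat\<close> assms(15) \<mu>hat0 by (smt (verit) decseqD le0)
    then show ?thesis
      using rS[of n] that by (force simp: S_def refine_success_def asr xbar)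
  qed
  have ysr: "(\<lambda>n. ybar (r n) h) \<longlonglongrightarrow> ys h" for h
    using ys by (simp add: r_def)
  have lim\<mu>0: "(\<lambda>n. \<mu>hat (r n)) \<longlonglongrightarrow> 0"
    using lim\<mu> M0 by simp
  note lims = stationary_limit[OF deriv contg k0 assms(4), where Y = "\<lambda>n. ybar (r n)"
      and e = "\<lambda>n. \<epsilon> (r n)" and \<mu> = "\<lambda>n. \<mu>hat (r n)" and j = "j k0" and ys = ys
      and \<gamma> = \<gamma> and \<gamma>' = \<gamma>ord]
  have Yr: "ybar (r n) \<in> standard_simplex (length (as k0) - 1)" for n
    using inner(1)[of "r n"] by (simp add: asr)
  have Ar: "approx_stationary (length (as k0)) (\<lambda>v. f (mat_apply (as k0) v)) \<tau> \<gamma> (\<epsilon> (r n)) (ybar (r n)) (j k0)" for n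
    using approx[of "r n"] by (simp add: asr jr \<phi>_def[abs_def])
  have "(\<lambda>n. mat_apply (as k0) (ybar (r n))) \<longlonglongrightarrow> mat_apply (as k0) ys"
    and st: "stationary_point f (convex hull A) (mat_apply (as k0) ys)"
    using lims[OF Yr Ar assms(16) lim\<epsilon> ysr \<mu>pos lim\<mu>0 other] by simp_all
  \<comment> \<open>The shift by \<open>Suc\<close> is due to a failed refine phase storing
    \<open>xbar k\<close> as the iterate \<open>x (Suc k)\<close>.\<close>
  moreover have "x \<circ> (Suc \<circ> r) = (\<lambda>n. mat_apply (as k0) (ybar (r n)))"
    using fail(1)[OF rS] xbar asr by (auto simp: fun_eq_iff)
  moreover have "strict_mono (Suc \<circ> r)" using r by (simp add: strict_mono_def)
  ultimately show ?thesis by (intro exI[of _ "mat_apply (as k0) ys"] exI[of _ "Suc \<circ> r"]) simp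
qed

end
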